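(* Let $(Q,+)$ be a group, $\varphi,\psi\in Aut(Q,+)$, $\beta,\gamma\in S_Q$, and let $\overline{\varphi}=I\varphi$ (so $\overline{\varphi}x=-\varphi x$). The left alinear quasigroup $(Q,\cdot)$ given by $x\cdot y=\overline{\varphi}x+\beta y$ and the quasigroup $(Q,\circ)$ given by $x\circ y=\gamma y+\psi x$ are orthogonal if and only if the mapping $(\psi^{-1}\gamma+\varphi^{-1}\beta)$, i.e. $y\mapsto\psi^{-1}\gamma y+\varphi^{-1}\beta y$, is a permutation of the set $Q$.
   Context: Groups are written additively but need not be commutative. $S_Q$ is the set of all permutations (bijections) of the set $Q$. Products of maps are compositions, $(\alpha\beta)x=\alpha(\beta x)$. $I$ denotes the map $Ix=-x$; every anti-automorphism $\overline{\varphi}$ of the group $(Q,+)$ (a permutation of $Q$ with $\overline{\varphi}(x+y)=\overline{\varphi}y+\overline{\varphi}x$) is written $\overline{\varphi}=I\varphi$ with $\varphi\in Aut(Q,+)$. Two quasigroups $(Q,\cdot)$ and $(Q,\circ)$ on the same set are orthogonal if for all $a,b\in Q$ the system $x\cdot y=a$, $x\circ y=b$ has a unique solution $(x,y)\in Q\times Q$. *)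

theory Defs
  imports "HOL-Algebra.Group"
begin

definition quasigroup :: "'a set \<Rightarrow> ('a \<Rightarrow> 'a \<Rightarrow> 'a) \<Rightarrow> bool" where
  "quasigroup Q f \<longleftrightarrow>
     (\<forall>x\<in>Q. \<forall>y\<in>Q. f x y \<in> Q) \<and>
     (\<forall>a\<in>Q. \<forall>b\<in>Q. \<exists>!x. x \<in> Q \<and> f x a = b) \<and>
     (\<forall>a\<in>Q. \<forall>b\<in>Q. \<exists>!y. y \<in> Q \<and> f a y = b)"

definition orthogonal_quasigroups ::
    "'a set \<Rightarrow> ('a \<Rightarrow> 'a \<Rightarrow> 'a) \<Rightarrow> ('a \<Rightarrow> 'a \<Rightarrow> 'a) \<Rightarrow> bool" where
  "orthogonal_quasigroups Q f g \<longleftrightarrow>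
     quasigroup Q f \<and> quasigroup Q g \<and>
     (\<forall>a\<in>Q. \<forall>b\<in>Q. \<exists>!p. p \<in> Q \<times> Q \<and> f (fst p) (snd p) = a \<and> g (fst p) (snd p) = b)"

end

(* Solving -\<phi> x + \<beta> y = a for x and substituting into \<gamma> y + \<psi> x = b eliminates x: after
   applying the inverse of \<psi>, the system becomes h y = \<psi>^(-1) b + \<phi>^(-1) a, where
   h = \<psi>^(-1) \<gamma> + \<phi>^(-1) \<beta>, with x determined by y. Every element of the group occurs as a
   right-hand side (take a = 0), so unique solvability for all a, b means that h is a
   permutation. *)

theory Submission
  imports Defs
begin

lemma bij_betw_ex1:
  assumes "bij_betw f A B" "b \<in> B"
  shows "\<exists>!x. x \<in> A \<and> f x = b"
  using assms by (auto simp: bij_betw_def inj_on_def)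

text \<open>This puts the permutation condition into the form in which orthogonality is stated,
  unique solvability for every right-hand side. Uniqueness gives injectivity and existence gives
  surjectivity.\<close>

lemma bij_betw_iff_ex1:
  "bij_betw f A B \<longleftrightarrow> f ` A \<subseteq> B \<and> (\<forall>b\<in>B. \<exists>!x. x \<in> A \<and> f x = b)"
proof
  assume "bij_betw f A B"
  then show "f ` A \<subseteq> B \<and> (\<forall>b\<in>B. \<exists>!x. x \<in> A \<and> f x = b)"
    using bij_betw_ex1[of f A B] by (auto simp: bij_betw_def)
next
  assume *: "f ` A \<subseteq> B \<and> (\<forall>b\<in>B. \<exists>!x. x \<in> A \<and> f x = b)"
  then have "inj_on f A"
    by (intro inj_onI) (metis image_subset_iff)
  moreover have "f ` A = B"
    using * by (metis image_eqI subsetI subset_antisym)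
  ultimately show "bij_betw f A B"
    by (simp add: bij_betw_def)
qed

text \<open>On the graph of \<open>s\<close> the second coordinate determines the pair, so the
  projection \<open>snd\<close> matches the solutions \<open>p\<close> one to one with the solutions
  \<open>y\<close>. This is the elimination of one unknown from a system.\<close>

lemma ex1_graph_iff: "(\<exists>!p. Q (snd p) \<and> fst p = s (snd p)) \<longleftrightarrow> (\<exists>!y. Q y)"
  by (auto simp: Ex1_def)

lemma quasigroup_opposite: "quasigroup Q f \<Longrightarrow> quasigroup Q (\<lambda>x y. f y x)"
  by (auto simp: quasigroup_def)

context group
begin

lemma bij_betw_m_inv: "bij_betw (\<lambda>x. inv x) (carrier G) (carrier G)"
  by (rule bij_betw_byWitness[where f' = "\<lambda>x. inv x"]) auto

text \<open>Cancelling the known factor leaves \<open>\<alpha> x = c\<close> or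
  \<open>\<beta> y = c\<close> with \<open>c\<close> in the carrier, and bijectivity solves that
  uniquely. Both operations of the theorem are of this type, up to swapping the arguments.\<close>

lemma quasigroup_isotope:
  assumes \<alpha>: "bij_betw \<alpha> (carrier G) (carrier G)"
    and \<beta>: "bij_betw \<beta> (carrier G) (carrier G)"
  shows "quasigroup (carrier G) (\<lambda>x y. \<alpha> x \<otimes> \<beta> y)"
proof -
  have cl: "\<alpha> x \<in> carrier G" "\<beta> x \<in> carrier G" if "x \<in> carrier G" for x
    using that \<alpha> \<beta> by (auto simp: bij_betw_apply)
  have "\<exists>!x. x \<in> carrier G \<and> \<alpha> x \<otimes> \<beta> a = b"
    if "a \<in> carrier G" "b \<in> carrier G" for a b
  proof -
    have "x \<in> carrier G \<and> \<alpha> x \<otimes> \<beta> a = b \<longleftrightarrow> x \<in> carrier G \<and> \<alpha> x = b \<otimes> inv \<beta> a" for x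
      using that cl using inv_solve_right[of "\<alpha> x" b "\<beta> a"] by auto
    then show ?thesis
      using bij_betw_ex1[OF \<alpha>, of "b \<otimes> inv \<beta> a"] that cl by simp
  qed
  moreover have "\<exists>!y. y \<in> carrier G \<and> \<alpha> a \<otimes> \<beta> y = b"
    if "a \<in> carrier G" "b \<in> carrier G" for a b
  proof -
    have "y \<in> carrier G \<and> \<alpha> a \<otimes> \<beta> y = b \<longleftrightarrow> y \<in> carrier G \<and> \<beta> y = inv \<alpha> a \<otimes> b" for y
      using that cl using inv_solve_left[of "\<beta> y" "\<alpha> a" b] by auto
    then show ?thesis
      using bij_betw_ex1[OF \<beta>, of "inv \<alpha> a \<otimes> b"] that cl by simp
  qed
  ultimately show ?thesis
    using cl by (simp add: quasigroup_def)
qed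

end

theorem theorem34:
  fixes G (structure)
    and \<phi> \<psi> \<beta> \<gamma> :: "'a \<Rightarrow> 'a"
  assumes "group G"
    and "\<phi> \<in> iso G G"
    and "\<psi> \<in> iso G G"
    and "bij_betw \<beta> (carrier G) (carrier G)"
    and "bij_betw \<gamma> (carrier G) (carrier G)"
  shows "quasigroup (carrier G) (\<lambda>x y. inv (\<phi> x) \<otimes> \<beta> y) \<and>
    quasigroup (carrier G) (\<lambda>x y. \<gamma> y \<otimes> \<psi> x) \<and>
    (orthogonal_quasigroups (carrier G) (\<lambda>x y. inv (\<phi> x) \<otimes> \<beta> y) (\<lambda>x y. \<gamma> y \<otimes> \<psi> x) \<longleftrightarrow>
      bij_betw (\<lambda>y. inv_into (carrier G) \<psi> (\<gamma> y) \<otimes> inv_into (carrier G) \<phi> (\<beta> y))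
        (carrier G) (carrier G))"
proof -
  interpret group G by fact
  let ?C = "carrier G"
  let ?\<phi>' = "inv_into ?C \<phi>" and ?\<psi>' = "inv_into ?C \<psi>"
  let ?h = "\<lambda>y. ?\<psi>' (\<gamma> y) \<otimes> ?\<phi>' (\<beta> y)"
  let ?f = "\<lambda>x y. inv (\<phi> x) \<otimes> \<beta> y" and ?g = "\<lambda>x y. \<gamma> y \<otimes> \<psi> x"
  have \<phi>_bij: "bij_betw \<phi> ?C ?C" and \<psi>_bij: "bij_betw \<psi> ?C ?C"
    using assms by (auto simp: iso_def)
  have \<phi>'_iso: "?\<phi>' \<in> iso G G" and \<psi>'_iso: "?\<psi>' \<in> iso G G"
    using assms by (auto intro: iso_set_sym)
  then have \<phi>'_hom: "?\<phi>' \<in> hom G G" and \<psi>'_hom: "?\<psi>' \<in> hom G G"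
    by (auto simp: iso_def)
  have cl [simp]: "\<phi> x \<in> ?C" "\<psi> x \<in> ?C" "\<beta> x \<in> ?C" "\<gamma> x \<in> ?C" "?\<phi>' x \<in> ?C" "?\<psi>' x \<in> ?C"
    if "x \<in> ?C" for x
    using that assms(4,5) \<phi>_bij \<psi>_bij \<phi>'_hom \<psi>'_hom
    by (auto simp: bij_betw_apply hom_in_carrier)
  have \<phi>_eq_iff: "\<phi> x = z \<longleftrightarrow> x = ?\<phi>' z"
    if "x \<in> ?C" "z \<in> ?C" for x z
    using that \<phi>_bij by (auto simp: bij_betw_inv_into_left bij_betw_inv_into_right)
  have qf: "quasigroup ?C ?f"
    using quasigroup_isotope[OF bij_betw_trans[OF \<phi>_bij bij_betw_m_inv] assms(4)]
    by (simp add: comp_def)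
  \<comment> \<open>Here \<open>y\<close> stands on the left, so \<open>?g\<close> is the opposite
    of an isotope.\<close>
  have qg: "quasigroup ?C ?g"
    using quasigroup_opposite[OF quasigroup_isotope[OF assms(5) \<psi>_bij]] .
  have f_iff: "?f x y = a \<longleftrightarrow> x = ?\<phi>' (\<beta> y) \<otimes> inv (?\<phi>' a)"
    if "x \<in> ?C" "y \<in> ?C" "a \<in> ?C" for x y a
  proof -
    \<comment> \<open>Without commutativity the order matters: the equation first becomes
      \<open>\<beta> y = \<phi> x \<otimes> a\<close>, and then \<open>a\<close> is cancelled on the
      right.\<close>
    have "?f x y = a \<longleftrightarrow> \<phi> x = \<beta> y \<otimes> inv a"
      using that inv_solve_left'[of a "\<phi> x" "\<beta> y"] inv_solve_right[of "\<phi> x" "\<beta> y" a] by auto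
    also have "\<dots> \<longleftrightarrow> x = ?\<phi>' (\<beta> y \<otimes> inv a)"
      using that by (simp add: \<phi>_eq_iff)
    also have "?\<phi>' (\<beta> y \<otimes> inv a) = ?\<phi>' (\<beta> y) \<otimes> inv (?\<phi>' a)"
      using that \<phi>'_hom
      by (simp add: hom_mult group_hom.hom_inv group_hom.intro group_hom_axioms.intro)
    finally show ?thesis .
  qed
  have g_iff: "?g x y = b \<longleftrightarrow> ?\<psi>' (\<gamma> y) \<otimes> x = ?\<psi>' b"
    if "x \<in> ?C" "y \<in> ?C" "b \<in> ?C" for x y b
  proof -
    \<comment> \<open>The inverse of \<open>\<psi>\<close> is injective on the image of
      \<open>\<psi>\<close>, which is the whole carrier. Applying it leaves \<open>x\<close> bare as
      the right factor, ready for substitution.\<close>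
    have "?g x y = b \<longleftrightarrow> ?\<psi>' (?g x y) = ?\<psi>' b"
      using that inv_into_injective[of ?C \<psi> "?g x y" b] bij_betw_imp_surj_on[OF \<psi>_bij] by auto
    also have "?\<psi>' (?g x y) = ?\<psi>' (\<gamma> y) \<otimes> x"
      using that \<psi>'_hom \<psi>_bij by (simp add: hom_mult bij_betw_inv_into_left)
    finally show ?thesis .
  qed
  have system_iff: "?f x y = a \<and> ?g x y = b \<longleftrightarrow>
      x = ?\<phi>' (\<beta> y) \<otimes> inv (?\<phi>' a) \<and> ?h y = ?\<psi>' b \<otimes> ?\<phi>' a"
    if "x \<in> ?C" "y \<in> ?C" "a \<in> ?C" "b \<in> ?C" for x y a b
  proof -
    \<comment> \<open>After substituting for \<open>x\<close>, the term with \<open>a\<close> is the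
      rightmost factor. Reassociating therefore exposes \<open>?h y\<close>, and that factor moves
      across without commutativity.\<close>
    have "?\<psi>' (\<gamma> y) \<otimes> (?\<phi>' (\<beta> y) \<otimes> inv (?\<phi>' a)) = ?\<psi>' b \<longleftrightarrow> ?h y = ?\<psi>' b \<otimes> ?\<phi>' a"
      using that inv_solve_right'[of "?\<psi>' b" "?h y" "?\<phi>' a"] by (auto simp: m_assoc)
    then show ?thesis
      using that f_iff g_iff by auto
  qed
  have unique_iff: "(\<exists>!p. p \<in> ?C \<times> ?C \<and> ?f (fst p) (snd p) = a \<and> ?g (fst p) (snd p) = b)
      \<longleftrightarrow> (\<exists>!y. y \<in> ?C \<and> ?h y = ?\<psi>' b \<otimes> ?\<phi>' a)" (is "(\<exists>!p. ?P p) \<longleftrightarrow> (\<exists>!y. ?Q y)")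
    if "a \<in> ?C" "b \<in> ?C" for a b
  proof -
    let ?s = "\<lambda>y. ?\<phi>' (\<beta> y) \<otimes> inv (?\<phi>' a)"
    have "?P p \<longleftrightarrow> ?Q (snd p) \<and> fst p = ?s (snd p)" for p
    proof (cases p)
      case (Pair x y)
      then show ?thesis
        using that system_iff[of x y a b] by auto
    qed
    then show ?thesis
      using ex1_graph_iff[of ?Q ?s] by simp
  qed
  \<comment> \<open>The right-hand sides arising from pairs \<open>a\<close>, \<open>b\<close> are
    exactly the elements of the carrier: closure gives one inclusion, and the pair
    \<open>\<one>\<close>, \<open>\<psi> c\<close> yields any given \<open>c\<close>.\<close>
  have "(\<forall>a\<in>?C. \<forall>b\<in>?C. \<exists>!y. y \<in> ?C \<and> ?h y = ?\<psi>' b \<otimes> ?\<phi>' a)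
      \<longleftrightarrow> (\<forall>c\<in>?C. \<exists>!y. y \<in> ?C \<and> ?h y = c)" (is "?L \<longleftrightarrow> ?R")
  proof
    assume L: ?L
    show ?R
    proof
      fix c assume c: "c \<in> ?C"
      have "?\<psi>' (\<psi> c) \<otimes> ?\<phi>' \<one> = c"
        using c \<psi>_bij \<phi>'_hom by (simp add: bij_betw_inv_into_left hom_one)
      then show "\<exists>!y. y \<in> ?C \<and> ?h y = c"
        using L[rule_format, of \<one> "\<psi> c"] c by simp
    qed
  qed simp
  then have "orthogonal_quasigroups ?C ?f ?g \<longleftrightarrow> bij_betw ?h ?C ?C"
    using qf qg unique_iff
    by (simp add: orthogonal_quasigroups_def bij_betw_iff_ex1 image_subset_iff)
  with qf qg show ?thesis
    by blast
qed

end
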